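(* Let $N\ge 1$ and $n\in\mathbb{N}$. Suppose that $u\in L^{p}(\mathbb{R}^N)$ for some $1\le p<+\infty$ and that the function $(x,h)\mapsto \frac{|u(x+h)-2u(x)+u(x-h)|}{|h|^2}\rho_n(h)$ belongs to $L^{1}(\mathbb{R}^N\times\mathbb{R}^N)$. Then $\mathfrak{H}_nu\in L^{1}(\mathbb{R}^N,\mathbb{R}^{N\times N})$ and for any $\varphi\in C_c^2(\mathbb{R}^N)$ and $i,j=1,\dots,N$, $$\langle \mathfrak{H}_n^{ij}u,\varphi\rangle=\int_{\mathbb{R}^N}H_n^{ij}u(x)\,\varphi(x)\,dx,$$ and therefore $H_nu=\mathfrak{H}_nu$ almost everywhere as functions.
   Context: Standing assumptions: $(\rho_n)_{n\in\mathbb{N}}$ is a sequence of radial functions on $\mathbb{R}^N$ such that for all $n$: $\rho_n\ge 0$, $\int_{\mathbb{R}^N}\rho_n(x)\,dx=1$, and $\lim_{n\to\infty}\int_{|x|>\gamma}\rho_n(x)\,dx=0$ for every $\gamma>0$. Non-local Hessian: whenever the Lebesgue integral makes sense, $$H_nu(x):=\frac{N(N+2)}{2}\int_{\mathbb{R}^N}\frac{u(x+h)-2u(x)+u(x-h)}{|h|^2}\,\frac{h\otimes h-\frac{|h|^2}{N+2}I_N}{|h|^2}\,\rho_n(h)\,dh\in\mathbb{R}^{N\times N},$$ where $I_N$ is the $N\times N$ identity matrix, $h\otimes h=hh^{\top}$, and $H_n^{ij}u$ is the $(i,j)$ entry. For $u\in C_c^2(\mathbb{R}^N)$ this integral exists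 for every $x$. Distributional non-local Hessian: for $u\in L^p(\mathbb{R}^N)$, $\mathfrak{H}_nu$ is defined componentwise by $\langle\mathfrak{H}_n^{ij}u,\varphi\rangle:=\int_{\mathbb{R}^N}u\,H_n^{ij}\varphi\,dx$ for $\varphi\in C_c^\infty(\mathbb{R}^N)$; the same formula is used for $\varphi\in C_c^2(\mathbb{R}^N)$. The assertion $\mathfrak{H}_nu\in L^1$ means that the distribution is represented by an $L^1$ function. *)

theory Defs
  imports "HOL-Analysis.Analysis"
begin

text \<open>
  \<open>\<real>\<^sup>N\<close> is \<^typ>\<open>real^'n\<close> with \<open>N = CARD('n)\<close>. Integrals are Lebesgue (Bochner) integrals with respect to
  the complete measure \<^const>\<open>lebesgue\<close>. As the Bochner integral of a non-integrable function is \<open>0\<close>,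
  existence of the non-local Hessian at a point is a separate predicate, \<open>nl_hessian_exists\<close>.
\<close>

definition radial_kernels :: "(nat \<Rightarrow> real^'n \<Rightarrow> real) \<Rightarrow> bool" where
  "radial_kernels \<rho> \<longleftrightarrow>
     (\<forall>n. (\<forall>x y. norm x = norm y \<longrightarrow> \<rho> n x = \<rho> n y) \<and>
          (\<forall>x. 0 \<le> \<rho> n x) \<and>
          integrable lebesgue (\<rho> n) \<and>
          (LINT x|lebesgue. \<rho> n x) = 1) \<and>
     (\<forall>\<gamma>>0. (\<lambda>n. LINT x:{x. \<gamma> < norm x}|lebesgue. \<rho> n x) \<longlonglongrightarrow> 0)"

definition in_Lp :: "real \<Rightarrow> (real^'n \<Rightarrow> real) \<Rightarrow> bool" where
  "in_Lp p u \<longleftrightarrow> u \<in> borel_measurable lebesgue \<and> integrable lebesgue (\<lambda>x. \<bar>u x\<bar> powr p)"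

primrec C_k :: "nat \<Rightarrow> (real^'n \<Rightarrow> real) \<Rightarrow> bool" where
  "C_k 0 f \<longleftrightarrow> continuous_on UNIV f"
| "C_k (Suc k) f \<longleftrightarrow>
     (\<forall>x. f differentiable (at x)) \<and>
     (\<forall>i. C_k k (\<lambda>x. frechet_derivative f (at x) (axis i 1)))"

definition compact_support :: "(real^'n \<Rightarrow> real) \<Rightarrow> bool" where
  "compact_support f \<longleftrightarrow> compact (closure {x. f x \<noteq> 0})"

definition C_c_k :: "nat \<Rightarrow> (real^'n \<Rightarrow> real) \<Rightarrow> bool" where
  "C_c_k k f \<longleftrightarrow> C_k k f \<and> compact_support f"

definition C_c_infty :: "(real^'n \<Rightarrow> real) \<Rightarrow> bool" where
  "C_c_infty f \<longleftrightarrow> (\<forall>k. C_k k f) \<and> compact_support f"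

definition second_diff :: "(real^'n \<Rightarrow> real) \<Rightarrow> real^'n \<Rightarrow> real^'n \<Rightarrow> real" where
  "second_diff u x h = u (x + h) - 2 * u x + u (x - h)"

definition outer :: "real^'n \<Rightarrow> real^'n \<Rightarrow> real^'n^'n" where
  "outer a b = (\<chi> i j. a $ i * b $ j)"

text \<open>Division by zero makes the integrand vanish at the single point \<open>h = 0\<close>, a null set.\<close>

definition nl_hessian_integrand ::
    "(real^'n \<Rightarrow> real) \<Rightarrow> (real^'n \<Rightarrow> real) \<Rightarrow> real^'n \<Rightarrow> real^'n \<Rightarrow> real^'n^'n" where
  "nl_hessian_integrand r u x h =
     (second_diff u x h / (norm h)\<^sup>2 * r h) *\<^sub>R
       ((1 / (norm h)\<^sup>2) *\<^sub>R
          (outer h h - ((norm h)\<^sup>2 / (real CARD('n) + 2)) *\<^sub>R mat 1))"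

definition nl_hessian_exists :: "(real^'n \<Rightarrow> real) \<Rightarrow> (real^'n \<Rightarrow> real) \<Rightarrow> real^'n \<Rightarrow> bool" where
  "nl_hessian_exists r u x \<longleftrightarrow> integrable lebesgue (nl_hessian_integrand r u x)"

definition nl_hessian :: "(real^'n \<Rightarrow> real) \<Rightarrow> (real^'n \<Rightarrow> real) \<Rightarrow> real^'n \<Rightarrow> real^'n^'n" where
  "nl_hessian r u x =
     (real CARD('n) * (real CARD('n) + 2) / 2) *\<^sub>R
       (LINT h|lebesgue. nl_hessian_integrand r u x h)"

definition dist_nl_hessian ::
    "(real^'n \<Rightarrow> real) \<Rightarrow> (real^'n \<Rightarrow> real) \<Rightarrow> 'n \<Rightarrow> 'n \<Rightarrow> (real^'n \<Rightarrow> real) \<Rightarrow> real" where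
  "dist_nl_hessian r u i j \<phi> = (LINT x|lebesgue. u x * nl_hessian r \<phi> x $ i $ j)"

definition represents_dist_nl_hessian ::
    "(real^'n \<Rightarrow> real) \<Rightarrow> (real^'n \<Rightarrow> real) \<Rightarrow> (real^'n \<Rightarrow> real^'n^'n) \<Rightarrow> bool" where
  "represents_dist_nl_hessian r u V \<longleftrightarrow>
     integrable lebesgue V \<and>
     (\<forall>\<phi>. C_c_infty \<phi> \<longrightarrow>
        (\<forall>i j. dist_nl_hessian r u i j \<phi> = (LINT x|lebesgue. V x $ i $ j * \<phi> x)))"

end

theory Submission
  imports Defs
begin

text \<open>
  The second difference is symmetric: translating the two outer terms moves it from a test function
  \<open>\<phi>\<close> onto \<open>u\<close>,
  \[ \int u(x)\,(\phi(x+h) - 2\phi(x) + \phi(x-h))\,dx = \int (u(x+h) - 2u(x) + u(x-h))\,\phi(x)\,dx \]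
  for each fixed \<open>h\<close> (\<open>second_diff_symmetric\<close>). Multiplying by the matrix weight of the non-local
  Hessian, which depends on \<open>h\<close> alone, and integrating over \<open>h\<close> gives the claimed identity once the
  order of integration may be exchanged on both sides.

  On the side of \<open>u\<close> the exchange is the hypothesis itself, since the normalised matrix
  \<open>nl_weight\<close> and \<open>\<phi>\<close> are bounded. On the side of \<open>\<phi>\<close> the second difference is at most
  \<open>C \<bar>h\<bar>\<^sup>2\<close>, and it vanishes unless one of \<open>x\<close>, \<open>x + h\<close>, \<open>x - h\<close> lies in the support of \<open>\<phi>\<close>.
  Since \<open>\<bar>u\<bar> \<le> 1 + \<bar>u\<bar>\<^sup>p\<close> on these translates of the support, the integral over \<open>x\<close> is bounded
  uniformly in \<open>h\<close>, and the kernel has finite mass in \<open>h\<close> (\<open>integrable_Lp_mult_kernel\<close>).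
  Both exchanges are combined in \<open>nl_hessian_integration_by_parts\<close>.

  Fubini's theorem is applied to Borel functions on a product of Borel measures. The given functions
  are only Lebesgue measurable, so they are first replaced by Borel functions that agree with them
  almost everywhere; the last part shows that neither the hypothesis nor the non-local Hessians feel
  the difference outside a null set.

  Uniqueness of the representing function is the fundamental lemma of the calculus of variations. It
  needs smooth functions that converge to the indicator of a box; these are products over the
  coordinates of rescaled copies of \<open>exp (-1/t)\<close>.
\<close>

section \<open>Functions of class \<open>C\<^sup>k\<close> and their second differences\<close>

lemma C_k_continuous: "C_k k f \<Longrightarrow> continuous_on UNIV f"
  by (cases k) (auto intro!: differentiable_imp_continuous_on simp: differentiable_on_def)

lemma C_k_Suc_imp: "C_k (Suc k) f \<Longrightarrow> C_k k f"
proof (induction k arbitrary: f)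
  case 0
  then show ?case using C_k_continuous by (metis C_k.simps(1))
next
  case (Suc k)
  show ?case
    unfolding C_k.simps
  proof (intro conjI allI)
    show "f differentiable (at x)" for x using Suc.prems by simp
    have "C_k (Suc k) (\<lambda>x. frechet_derivative f (at x) (axis i 1))" for i
      using Suc.prems C_k.simps(2)[of "Suc k" f] by blast
    then show "C_k k (\<lambda>x. frechet_derivative f (at x) (axis i 1))" for i
      using Suc.IH by simp
  qed
qed

lemma C_k_const: "C_k k (\<lambda>x. c)"
  by (induction k arbitrary: c) simp_all

lemma C_k_add:
  assumes "C_k k f" "C_k k g"
  shows "C_k k (\<lambda>x. f x + g x)"
  using assms
proof (induction k arbitrary: f g)
  case 0
  then show ?case by (auto intro: continuous_intros)
next
  case (Suc k)
  have d: "f differentiable (at x)" "g differentiable (at x)" for x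
    using Suc.prems by auto
  have "frechet_derivative (\<lambda>x. f x + g x) (at x)
      = (\<lambda>v. frechet_derivative f (at x) v + frechet_derivative g (at x) v)" for x
    using d[of x] by (intro frechet_derivative_at[symmetric] has_derivative_add)
      (auto simp: frechet_derivative_works)
  then show ?case using Suc d by simp
qed

lemma C_k_mult:
  assumes "C_k k f" "C_k k g"
  shows "C_k k (\<lambda>x. f x * g x)"
  using assms
proof (induction k arbitrary: f g)
  case 0
  then show ?case by (auto intro: continuous_intros)
next
  case (Suc k)
  have d: "f differentiable (at x)" "g differentiable (at x)" for x
    using Suc.prems by auto
  have "frechet_derivative (\<lambda>x. f x * g x) (at x)
      = (\<lambda>v. f x * frechet_derivative g (at x) v + frechet_derivative f (at x) v * g x)" for x
    using d[of x] by (intro frechet_derivative_at[symmetric] has_derivative_mult)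
      (auto simp: frechet_derivative_works)
  moreover have "C_k k (\<lambda>x. f x * frechet_derivative g (at x) (axis i 1)
      + frechet_derivative f (at x) (axis i 1) * g x)" for i
    using Suc.prems by (intro C_k_add Suc.IH C_k_Suc_imp[of k f] C_k_Suc_imp[of k g]) auto
  ultimately show ?case using d by simp
qed

lemma C_k_prod:
  assumes "finite I" "\<And>i. i \<in> I \<Longrightarrow> C_k k (f i)"
  shows "C_k k (\<lambda>x. \<Prod>i\<in>I. f i x)"
  using assms by (induction I rule: finite_induct) (auto intro: C_k_const C_k_mult)

lemma C_c_infty_imp_C_c_k: "C_c_infty \<phi> \<Longrightarrow> C_c_k k \<phi>"
  by (simp add: C_c_infty_def C_c_k_def)

lemma C_c_k_continuous: "C_c_k k \<phi> \<Longrightarrow> continuous_on UNIV \<phi>"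
  using C_k_continuous by (auto simp: C_c_k_def)

lemma continuous_compact_support_bounded:
  fixes f :: "'a::topological_space \<Rightarrow> real"
  assumes "continuous_on UNIV f" "compact B" "\<And>x. x \<notin> B \<Longrightarrow> f x = 0"
  shows "\<exists>M\<ge>0. \<forall>x. \<bar>f x\<bar> \<le> M"
proof -
  have "bounded (f ` B)"
    by (intro compact_imp_bounded compact_continuous_image continuous_on_subset[OF assms(1)] assms(2)) simp
  then obtain M where M: "M > 0" "\<And>x. x \<in> B \<Longrightarrow> \<bar>f x\<bar> \<le> M"
    by (auto simp: bounded_pos)
  have "\<bar>f x\<bar> \<le> M" for x using M assms(3)[of x] by (cases "x \<in> B") auto
  then show ?thesis using M(1) by (intro exI[of _ M]) auto
qed

lemma borel_measurable_C_c_k: "C_c_k k \<phi> \<Longrightarrow> \<phi> \<in> borel_measurable borel"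
  by (intro borel_measurable_continuous_onI C_c_k_continuous)

lemma C_c_k_support:
  assumes "C_c_k k \<phi>"
  obtains B M where "compact B" "\<And>x. x \<notin> B \<Longrightarrow> \<phi> x = 0" "0 \<le> M" "\<And>x. \<bar>\<phi> x\<bar> \<le> M"
proof -
  define B where "B = closure {x. \<phi> x \<noteq> 0}"
  have B: "compact B" using assms by (auto simp: C_c_k_def compact_support_def B_def)
  have 0: "\<phi> x = 0" if "x \<notin> B" for x
    using that closure_subset[of "{x. \<phi> x \<noteq> 0}"] unfolding B_def by auto
  obtain M where M: "0 \<le> M" "\<And>x. \<bar>\<phi> x\<bar> \<le> M"
    using continuous_compact_support_bounded[OF C_c_k_continuous[OF assms] B 0] by blast
  show thesis by (rule that[of B M]) (use B 0 M in auto)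
qed

text \<open>
  The mean value inequality. The factor \<open>CARD('n)\<close> comes from bounding the \<open>\<ell>\<^sup>1\<close> norm of a vector
  by that many copies of its Euclidean norm.
\<close>
lemma partial_derivatives_bounded_imp_lipschitz:
  fixes f :: "real^'n \<Rightarrow> real"
  assumes d: "\<And>x. f differentiable (at x)"
    and M: "\<And>x i. \<bar>frechet_derivative f (at x) (axis i 1)\<bar> \<le> M"
  shows "\<bar>f x - f y\<bar> \<le> real CARD('n) * M * norm (x - y)"
proof -
  have "M \<ge> 0" using order_trans[OF abs_ge_zero M[of undefined undefined]] .
  have on: "onorm (frechet_derivative f (at x)) \<le> real CARD('n) * M" for x
  proof (rule onorm_bound)
    fix v :: "real^'n"
    interpret linear "frechet_derivative f (at x)" using linear_frechet_derivative d by blast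
    have "frechet_derivative f (at x) v = frechet_derivative f (at x) (\<Sum>i\<in>UNIV. v $ i *\<^sub>R axis i 1)"
      by (simp add: basis_expansion flip: scalar_mult_eq_scaleR)
    also have "\<dots> = (\<Sum>i\<in>UNIV. v $ i * frechet_derivative f (at x) (axis i 1))"
      by (simp add: sum scaleR)
    also have "\<bar>\<dots>\<bar> \<le> (\<Sum>i\<in>(UNIV::'n set). norm v * M)"
      using M by (intro order_trans[OF sum_abs] sum_mono)
        (auto simp: abs_mult intro!: mult_mono component_le_norm_cart)
    finally show "norm (frechet_derivative f (at x) v) \<le> real CARD('n) * M * norm v"
      by (simp add: mult_ac)
  qed (use \<open>M \<ge> 0\<close> in simp)
  have "norm (f x - f y) \<le> real CARD('n) * M * norm (x - y)"
    using d on by (intro differentiable_bound[of UNIV f "\<lambda>x. frechet_derivative f (at x)"])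
      (auto simp: frechet_derivative_works)
  then show ?thesis by simp
qed

lemma frechet_derivative_eq_0_outside_support:
  fixes f :: "'a::real_normed_vector \<Rightarrow> 'b::real_normed_vector"
  assumes "closed B" "\<And>x. x \<notin> B \<Longrightarrow> f x = 0" "x \<notin> B"
  shows "frechet_derivative f (at x) = (\<lambda>v. 0)"
proof -
  have "((\<lambda>x. 0::'b) has_derivative (\<lambda>v. 0)) (at x)" by simp
  then have "(f has_derivative (\<lambda>v. 0)) (at x)"
    by (rule has_derivative_transform_within_open[of _ _ _ _ "- B"]) (use assms in auto)
  then show ?thesis by (rule frechet_derivative_at[symmetric])
qed

text \<open>
  The second difference at \<open>x\<close> is \<open>g x - g (x - h)\<close> for the first difference \<open>g y = \<phi> (y + h) - \<phi> y\<close>.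
  The gradient of \<open>g\<close> is itself a difference of the gradient of \<open>\<phi>\<close>, hence \<open>O(\<bar>h\<bar>)\<close> by the
  bounds on the second derivatives; the mean value inequality for \<open>g\<close> supplies the second
  factor \<open>\<bar>h\<bar>\<close>.
\<close>
lemma second_diff_le_square:
  fixes \<phi> :: "real^'n \<Rightarrow> real"
  assumes "C_k 2 \<phi>" "compact B" and 0: "\<And>x. x \<notin> B \<Longrightarrow> \<phi> x = 0"
  shows "\<exists>C\<ge>0. \<forall>x h. \<bar>second_diff \<phi> x h\<bar> \<le> C * (norm h)\<^sup>2"
proof -
  define D where "D i x = frechet_derivative \<phi> (at x) (axis i 1)" for i x
  define D2 where "D2 i j x = frechet_derivative (D i) (at x) (axis j 1)" for i j x
  have "closed B" using \<open>compact B\<close> compact_imp_closed by blast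
  have d: "\<phi> differentiable (at x)" "D i differentiable (at x)" "continuous_on UNIV (D2 i j)" for i j x
    using assms(1) by (auto simp: numeral_2_eq_2 D_def[abs_def] D2_def[abs_def])
  have D0: "D i x = 0" if "x \<notin> B" for i x
    using frechet_derivative_eq_0_outside_support[OF \<open>closed B\<close> 0 that] by (simp add: D_def)
  have D20: "D2 i j x = 0" if "x \<notin> B" for i j x
    using frechet_derivative_eq_0_outside_support[OF \<open>closed B\<close> D0 that] by (simp add: D2_def)
  have "\<forall>i j. \<exists>M\<ge>0. \<forall>x. \<bar>D2 i j x\<bar> \<le> M"
    by (intro allI continuous_compact_support_bounded[OF d(3) \<open>compact B\<close> D20])
  then obtain m where m: "\<And>i j. 0 \<le> m i j" "\<And>i j x. \<bar>D2 i j x\<bar> \<le> m i j" by metis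
  define M where "M = (\<Sum>i\<in>UNIV. \<Sum>j\<in>UNIV. m i j)"
  have "m i j \<le> M" for i j
  proof -
    have "m i j \<le> (\<Sum>j\<in>UNIV. m i j)" using m(1) by (intro member_le_sum) auto
    also have "\<dots> \<le> M" unfolding M_def using m(1) by (intro member_le_sum sum_nonneg) auto
    finally show ?thesis .
  qed
  then have M: "\<bar>D2 i j x\<bar> \<le> M" for i j x by (rule order_trans[OF m(2)])
  have "M \<ge> 0" unfolding M_def using m(1) by (intro sum_nonneg) auto
  define L where "L = real CARD('n) * M"
  have L: "\<bar>D i x - D i y\<bar> \<le> L * norm (x - y)" for i x y
    unfolding L_def using d M by (intro partial_derivatives_bounded_imp_lipschitz) (auto simp: D2_def)
  have "\<bar>second_diff \<phi> x h\<bar> \<le> (real CARD('n) * L) * (norm h)\<^sup>2" for x h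
  proof -
    define g where "g y = \<phi> (y + h) - \<phi> y" for y
    \<comment> \<open>The gradient of \<open>g\<close> at \<open>y\<close> is the increment from \<open>y\<close> to \<open>y + h\<close> of the gradient of \<open>\<phi>\<close>.\<close>
    have g: "(g has_derivative (\<lambda>v. frechet_derivative \<phi> (at (y + h)) v - frechet_derivative \<phi> (at y) v)) (at y)" for y
    proof -
      have "((\<lambda>y. \<phi> (y + h)) has_derivative frechet_derivative \<phi> (at (y + h))) (at y)"
      proof (rule has_derivative_compose[where f = "\<lambda>y. y + h" and f' = "\<lambda>v. v" and g = \<phi>])
        show "((\<lambda>y. y + h) has_derivative (\<lambda>v. v)) (at y)"
          using has_derivative_add[OF has_derivative_ident has_derivative_const] by simp
        show "(\<phi> has_derivative frechet_derivative \<phi> (at (y + h))) (at (y + h))"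
          using d(1) by (simp add: frechet_derivative_works)
      qed
      then show ?thesis
        unfolding g_def[abs_def] using d(1)[of y]
        by (intro has_derivative_diff) (auto simp: frechet_derivative_works)
    qed
    have "\<bar>frechet_derivative g (at y) (axis i 1)\<bar> \<le> L * norm h" for y i
      using L[of i "y + h" y] unfolding frechet_derivative_at[OF g, symmetric] by (simp add: D_def)
    then have "\<bar>g x - g (x - h)\<bar> \<le> real CARD('n) * (L * norm h) * norm (x - (x - h))"
      using g by (intro partial_derivatives_bounded_imp_lipschitz) (auto simp: differentiable_def)
    then show ?thesis by (simp add: g_def second_diff_def power2_eq_square algebra_simps)
  qed
  moreover have "0 \<le> real CARD('n) * L" unfolding L_def using \<open>M \<ge> 0\<close> by simp
  ultimately show ?thesis by blast
qed

text \<open>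
  The three indicators record where the second difference can be nonzero. They are what makes the bound
  integrable in \<open>x\<close>, with an integral that does not depend on \<open>h\<close>.
\<close>
lemma second_diff_le_square_on_support:
  fixes \<phi> :: "real^'n \<Rightarrow> real"
  assumes "C_k 2 \<phi>" "compact B" and 0: "\<And>x. x \<notin> B \<Longrightarrow> \<phi> x = 0"
  shows "\<exists>C\<ge>0. \<forall>x h. \<bar>second_diff \<phi> x h\<bar>
      \<le> C * (norm h)\<^sup>2 * (indicator B x + indicator B (x + h) + indicator B (x - h))"
proof -
  obtain C where C: "C \<ge> 0" "\<And>x h. \<bar>second_diff \<phi> x h\<bar> \<le> C * (norm h)\<^sup>2"
    using second_diff_le_square[OF assms] by blast
  have "\<bar>second_diff \<phi> x h\<bar>
      \<le> C * (norm h)\<^sup>2 * (indicator B x + indicator B (x + h) + indicator B (x - h))" for x h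
  proof (cases "x \<in> B \<or> x + h \<in> B \<or> x - h \<in> B")
    case True
    then have "1 \<le> (indicator B x + indicator B (x + h) + indicator B (x - h) :: real)"
      by (auto simp: indicator_def)
    then have "C * (norm h)\<^sup>2 * 1 \<le> C * (norm h)\<^sup>2 * (indicator B x + indicator B (x + h) + indicator B (x - h))"
      using C(1) by (intro mult_left_mono) auto
    then show ?thesis using C(2)[of x h] by linarith
  next
    case False
    then show ?thesis using C(1) 0 by (auto simp: second_diff_def)
  qed
  with C(1) show ?thesis by blast
qed

section \<open>Smooth bumps and the fundamental lemma of the calculus of variations\<close>

text \<open>
  The power \<open>(1/t)\<^sup>m\<close> makes the span of this family closed under differentiation, so that
  smoothness of \<open>flat_exp 0\<close> follows by one induction over all \<open>m\<close>.
\<close>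
definition flat_exp :: "nat \<Rightarrow> real \<Rightarrow> real" where
  "flat_exp m t = (if 0 < t then (1 / t) ^ m * exp (- (1 / t)) else 0)"

lemma flat_exp_div_tendsto_0: "((\<lambda>t. flat_exp m t / t) \<longlongrightarrow> 0) (at 0)"
proof (rule filterlim_split_at)
  show "((\<lambda>t. flat_exp m t / t) \<longlongrightarrow> 0) (at_left 0)"
    by (rule tendsto_eventually) (auto simp: flat_exp_def eventually_at_filter)
  have "((\<lambda>t::real. (1 / t) ^ Suc m / exp (1 / t)) \<longlongrightarrow> 0) (at_right 0)"
    by (rule filterlim_compose[OF tendsto_power_div_exp_0])
       (use filterlim_inverse_at_top_right in \<open>simp add: inverse_eq_divide\<close>)
  then show "((\<lambda>t. flat_exp m t / t) \<longlongrightarrow> 0) (at_right 0)"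
    by (rule Lim_transform_eventually)
       (auto simp: flat_exp_def eventually_at_filter exp_minus field_simps)
qed

lemma flat_exp_DERIV:
  "(flat_exp m has_real_derivative - real m * flat_exp (Suc m) t + flat_exp (m + 2) t) (at t)"
proof -
  consider "t < 0" | "t = 0" | "t > 0" by linarith
  then show ?thesis
  proof cases
    case 1
    have "((\<lambda>t. 0::real) has_real_derivative 0) (at t)" by simp
    then show ?thesis
      using 1
      by (subst DERIV_cong_ev[OF refl _ refl, where g = "\<lambda>t. 0"])
         (auto simp: flat_exp_def intro!: eventually_mono[OF eventually_nhds_in_open[of "{..<0}" t]])
  next
    case 2
    then show ?thesis
      using flat_exp_div_tendsto_0[of m] by (simp add: DERIV_def flat_exp_def)
  next
    case 3
    have "((\<lambda>t::real. (1 / t) ^ m * exp (- (1 / t))) has_real_derivative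
        - real m * flat_exp (Suc m) t + flat_exp (m + 2) t) (at t)"
      using 3 by (auto intro!: derivative_eq_intros simp: flat_exp_def)
        (cases m; simp add: field_simps power2_eq_square)
    then show ?thesis
      using 3
      by (subst DERIV_cong_ev[OF refl _ refl, where g = "\<lambda>t. (1 / t) ^ m * exp (- (1 / t))"])
         (auto simp: flat_exp_def intro!: eventually_mono[OF eventually_nhds_in_open[of "{0<..}" t]])
  qed
qed

text \<open>
  The constant \<open>c\<close> absorbs the chain rule factors, which lets the induction on \<open>k\<close> apply to each summand
  of the derivative.
\<close>
lemma C_k_flat_exp_coordinate:
  "C_k k (\<lambda>x::real^'n. c * flat_exp m (a * x $ i + b))"
proof (induction k arbitrary: c m)
  case 0
  have "continuous_on UNIV (flat_exp m)"
    by (rule continuous_at_imp_continuous_on) (use flat_exp_DERIV DERIV_isCont in blast)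
  then have "continuous_on UNIV (\<lambda>x::real^'n. flat_exp m (a * x $ i + b))"
    by (rule continuous_on_compose2) (auto intro!: continuous_intros)
  then show ?case by (auto intro!: continuous_intros)
next
  case (Suc k)
  have D: "((\<lambda>x::real^'n. c * flat_exp m (a * x $ i + b)) has_derivative
      (\<lambda>v. c * ((- real m * flat_exp (Suc m) (a * x $ i + b) + flat_exp (m + 2) (a * x $ i + b))
              * (a * v $ i)))) (at x)" for x
  proof (intro has_derivative_mult_right)
    have "((\<lambda>x::real^'n. a * x $ i + b) has_derivative (\<lambda>v. a * v $ i)) (at x)"
      by (auto intro!: derivative_eq_intros bounded_linear.has_derivative[OF bounded_linear_vec_nth])
    from has_derivative_compose[OF this flat_exp_DERIV[of m, unfolded has_field_derivative_def]]
    show "((\<lambda>x::real^'n. flat_exp m (a * x $ i + b)) has_derivative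
      (\<lambda>v. (- real m * flat_exp (Suc m) (a * x $ i + b) + flat_exp (m + 2) (a * x $ i + b))
              * (a * v $ i))) (at x)" .
  qed
  have "C_k k (\<lambda>x::real^'n. (c * a * axis j 1 $ i * - real m) * flat_exp (Suc m) (a * x $ i + b)
      + (c * a * axis j 1 $ i) * flat_exp (m + 2) (a * x $ i + b))" for j
    by (intro C_k_add Suc.IH)
  then have "C_k k (\<lambda>x::real^'n. frechet_derivative (\<lambda>x. c * flat_exp m (a * x $ i + b)) (at x) (axis j 1))" for j
    unfolding frechet_derivative_at[OF D, symmetric] by (simp add: algebra_simps)
  then show ?case
    using D by (auto simp: differentiable_def)
qed

definition box_bump :: "real \<Rightarrow> real^'n \<Rightarrow> real^'n \<Rightarrow> real^'n \<Rightarrow> real" where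
  "box_bump m a b x =
     (\<Prod>i\<in>UNIV. flat_exp 0 (m * (x $ i - a $ i)) * flat_exp 0 (m * (b $ i - x $ i)))"

lemma flat_exp_0_bounds: "0 \<le> flat_exp 0 t" "flat_exp 0 t \<le> 1"
  by (auto simp: flat_exp_def)

lemma box_bump_bounds: "0 \<le> box_bump m a b x" "box_bump m a b x \<le> 1"
  unfolding box_bump_def
  by (auto intro!: prod_nonneg prod_le_1 mult_le_one mult_nonneg_nonneg flat_exp_0_bounds)

lemma box_bump_outside:
  assumes "0 < m" "x \<notin> box a b" shows "box_bump m a b x = 0"
proof -
  obtain i where "x $ i \<le> a $ i \<or> b $ i \<le> x $ i"
    using assms(2) by (auto simp: mem_box_cart not_less)
  then have "flat_exp 0 (m * (x $ i - a $ i)) * flat_exp 0 (m * (b $ i - x $ i)) = 0"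
    using assms(1) by (auto simp: flat_exp_def zero_less_mult_iff)
  then show ?thesis unfolding box_bump_def by (intro prod_zero) auto
qed

lemma C_c_infty_box_bump:
  fixes a b :: "real^'n"
  assumes "0 < m" shows "C_c_infty (box_bump m a b)"
proof -
  have "C_k k (box_bump m a b)" for k
  proof -
    have "C_k k (\<lambda>x::real^'n. (1 * flat_exp 0 (m * x $ i + (- (m * a $ i))))
              * (1 * flat_exp 0 ((- m) * x $ i + m * b $ i)))" for i
      by (intro C_k_mult C_k_flat_exp_coordinate)
    then have "C_k k (\<lambda>x::real^'n. flat_exp 0 (m * (x $ i - a $ i)) * flat_exp 0 (m * (b $ i - x $ i)))" for i
      by (simp add: algebra_simps)
    then show ?thesis
      unfolding box_bump_def[abs_def] by (intro C_k_prod) auto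
  qed
  moreover have "compact_support (box_bump m a b)"
  proof -
    have "{x. box_bump m a b x \<noteq> 0} \<subseteq> box a b" using box_bump_outside[OF assms] by blast
    then have "bounded {x. box_bump m a b x \<noteq> 0}" using bounded_box bounded_subset by blast
    then show ?thesis unfolding compact_support_def by (simp add: compact_closure)
  qed
  ultimately show ?thesis unfolding C_c_infty_def by blast
qed

lemma box_bump_tendsto_indicator:
  "(\<lambda>k. box_bump (real (Suc k)) a b x) \<longlonglongrightarrow> indicator (box a b) x"
proof (cases "x \<in> box a b")
  case True
  have *: "(\<lambda>k. flat_exp 0 (real (Suc k) * s)) \<longlonglongrightarrow> 1" if "0 < s" for s
  proof -
    have "(\<lambda>k. exp (- (inverse (real (Suc k)) * (1 / s)))) \<longlonglongrightarrow> exp (- (0 * (1 / s)))"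
      by (intro tendsto_intros LIMSEQ_inverse_real_of_nat)
    then show ?thesis using that by (simp add: flat_exp_def divide_simps mult_ac)
  qed
  have "(\<lambda>k. box_bump (real (Suc k)) a b x) \<longlonglongrightarrow> (\<Prod>i\<in>(UNIV::'a set). 1 * 1)"
    unfolding box_bump_def using True by (intro tendsto_prod tendsto_mult *) (auto simp: mem_box_cart)
  then show ?thesis using True by simp
next
  case False
  then show ?thesis by (simp add: box_bump_outside)
qed

text \<open>
  Letting the bumps increase to the indicator of a box shows that \<open>f\<close> has integral zero over every box.
  By Lebesgue differentiation \<open>f\<close> is almost everywhere the limit of its averages over shrinking cubes,
  all of which are zero.
\<close>
lemma AE_eq_0_if_orthogonal_to_C_c_infty:
  fixes f :: "real^'n \<Rightarrow> real"
  assumes f: "integrable lebesgue f"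
    and orth: "\<And>\<phi>. C_c_infty \<phi> \<Longrightarrow> (LINT x|lebesgue. f x * \<phi> x) = 0"
  shows "AE x in lebesgue. f x = 0"
proof -
  have [measurable]: "f \<in> borel_measurable lebesgue" using f by auto
  have zero: "integral (cbox a b) f = 0" for a b
  proof -
    have bump: "box_bump (real (Suc k)) a b \<in> borel_measurable lebesgue" for k
    proof -
      have "continuous_on UNIV (box_bump (real (Suc k)) a b)"
        by (intro C_c_k_continuous[of 0] C_c_infty_imp_C_c_k C_c_infty_box_bump) simp
      then show ?thesis
        by (intro measurable_completion) (simp add: borel_measurable_continuous_onI)
    qed
    have "(\<lambda>k. LINT x|lebesgue. f x * box_bump (real (Suc k)) a b x)
        \<longlonglongrightarrow> (LINT x|lebesgue. f x * indicator (box a b) x)"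
    proof (rule integral_dominated_convergence[where w = "\<lambda>x. \<bar>f x\<bar>"])
      show "AE x in lebesgue. (\<lambda>k. f x * box_bump (real (Suc k)) a b x) \<longlonglongrightarrow> f x * indicator (box a b) x"
        by (intro AE_I2 tendsto_mult_left box_bump_tendsto_indicator)
      show "AE x in lebesgue. norm (f x * box_bump (real (Suc k)) a b x) \<le> \<bar>f x\<bar>" for k
        by (intro AE_I2) (simp add: abs_mult mult_left_le box_bump_bounds abs_of_nonneg[OF box_bump_bounds(1)])
      show "(\<lambda>x. f x * box_bump (real (Suc k)) a b x) \<in> borel_measurable lebesgue" for k
        using bump by (intro borel_measurable_times) auto
      show "(\<lambda>x. f x * indicator (box a b) x) \<in> borel_measurable lebesgue"
        by (intro borel_measurable_times borel_measurable_indicator) auto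
    qed (use f in simp)
    then have "(LINT x|lebesgue. f x * indicator (box a b) x) = 0"
      using orth[OF C_c_infty_box_bump] by (simp add: LIMSEQ_const_iff)
    then have "(LINT x:box a b|lebesgue. f x) = 0"
      by (simp add: set_lebesgue_integral_def mult.commute)
    moreover have "set_integrable lebesgue (box a b) f"
      using f by (intro integrable_mult_indicator[folded set_integrable_def]) (auto intro: fmeasurableD)
    ultimately show ?thesis
      by (simp add: set_lebesgue_integral_eq_integral integral_open_interval)
  qed
  have "f integrable_on cbox a b" for a b
    using integrable_on_subcbox[OF integrable_on_lebesgue[OF f]] by auto
  from integrable_ccontinuous_explicit[OF this] obtain N where "negligible N"
    and N: "\<And>x e. \<lbrakk>x \<notin> N; 0 < e\<rbrakk> \<Longrightarrow> \<exists>d>0. \<forall>h. 0 < h \<and> h < d \<longrightarrow>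
       norm (integral (cbox x (x + h *\<^sub>R One)) f /\<^sub>R h ^ DIM(real^'n) - f x) < e"
    by blast
  have "f x = 0" if x: "x \<notin> N" for x
  proof (rule ccontr)
    assume "f x \<noteq> 0"
    \<comment> \<open>All averages of \<open>f\<close> near \<open>x\<close> are \<open>0\<close>, hence at distance exactly \<open>\<bar>f x\<bar>\<close> from \<open>f x\<close>.\<close>
    then have "0 < \<bar>f x\<bar>" by simp
    from N[OF x this] obtain d where "d > 0" and
      d: "\<forall>h. 0 < h \<and> h < d \<longrightarrow> norm (integral (cbox x (x + h *\<^sub>R One)) f /\<^sub>R h ^ DIM(real^'n) - f x) < \<bar>f x\<bar>"
      by blast
    from d[rule_format, of "d / 2"] \<open>d > 0\<close> show False by (simp add: zero)
  qed
  moreover have "N \<in> null_sets lebesgue" using \<open>negligible N\<close> negligible_iff_null_sets by blast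
  ultimately show ?thesis by (intro AE_I'[of N]) auto
qed

lemma integrable_mult_C_c_k:
  fixes f \<phi> :: "real^'n \<Rightarrow> real"
  assumes f: "integrable lebesgue f" and \<phi>: "C_c_k k \<phi>"
  shows "integrable lebesgue (\<lambda>x. f x * \<phi> x)"
proof -
  obtain M where M: "0 \<le> M" "\<And>x. \<bar>\<phi> x\<bar> \<le> M" using C_c_k_support[OF \<phi>] by metis
  have m: "\<phi> \<in> borel_measurable lebesgue"
    using borel_measurable_C_c_k[OF \<phi>] by (intro measurable_completion) simp
  show ?thesis
  proof (rule Bochner_Integration.integrable_bound[OF integrable_mult_right[OF f, of M]])
    show "(\<lambda>x. f x * \<phi> x) \<in> borel_measurable lebesgue" using f m by (intro borel_measurable_times) auto
    show "AE x in lebesgue. norm (f x * \<phi> x) \<le> norm (M * f x)"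
      using M mult_right_mono[OF M(2) abs_ge_zero[of "f _"]] by (intro AE_I2) (auto simp: abs_mult mult.commute)
  qed
qed

lemma AE_eq_if_same_pairing_with_C_c_infty:
  fixes f g :: "real^'n \<Rightarrow> real"
  assumes f: "integrable lebesgue f" and g: "integrable lebesgue g"
    and eq: "\<And>\<phi>. C_c_infty \<phi> \<Longrightarrow> (LINT x|lebesgue. f x * \<phi> x) = (LINT x|lebesgue. g x * \<phi> x)"
  shows "AE x in lebesgue. f x = g x"
proof -
  have "AE x in lebesgue. f x - g x = 0"
  proof (rule AE_eq_0_if_orthogonal_to_C_c_infty)
    show "(LINT x|lebesgue. (f x - g x) * \<phi> x) = 0" if \<phi>: "C_c_infty \<phi>" for \<phi>
      using eq[OF \<phi>] integrable_mult_C_c_k[OF f C_c_infty_imp_C_c_k[OF \<phi>]]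
        integrable_mult_C_c_k[OF g C_c_infty_imp_C_c_k[OF \<phi>]]
      by (simp add: left_diff_distrib)
  qed (use f g in simp)
  then show ?thesis by simp
qed

section \<open>Translations and Borel representatives\<close>

lemma AE_lborel_translate:
  fixes a :: "'a::euclidean_space"
  assumes "AE x in lborel. P x"
  shows "AE x in lborel. P (a + x)"
  using assms by (subst (asm) lborel_distr_plus[of a, symmetric]) (erule AE_distrD[rotated], simp)

lemma AE_lborel_reflect:
  fixes a :: "'a::euclidean_space"
  assumes "AE x in lborel. P x"
  shows "AE x in lborel. P (a - x)"
proof -
  have "distr lborel borel (\<lambda>x. a - x) = lborel"
    using lborel_affine[of "-1" a] by (simp add: density_1)
  with assms have "AE x in distr lborel borel (\<lambda>x. a - x). P x" by (simp only:)
  then show ?thesis by (rule AE_distrD[rotated]) simp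
qed

lemma lborel_translate:
  fixes a :: "'a::euclidean_space" and f :: "'a \<Rightarrow> 'b::{banach, second_countable_topology}"
  assumes [measurable]: "f \<in> borel_measurable borel"
  shows "integrable lborel (\<lambda>x. f (x + a)) \<longleftrightarrow> integrable lborel f"
    and "(LINT x|lborel. f (x + a)) = (LINT x|lborel. f x)"
proof -
  have "integrable (distr lborel borel ((+) a)) f \<longleftrightarrow> integrable lborel (\<lambda>x. f (a + x))"
    by (rule integrable_distr_eq) auto
  then show "integrable lborel (\<lambda>x. f (x + a)) \<longleftrightarrow> integrable lborel f"
    by (simp add: lborel_distr_plus add.commute)
  have "(LINT x|distr lborel borel ((+) a). f x) = (LINT x|lborel. f (a + x))"
    by (rule integral_distr) auto
  then show "(LINT x|lborel. f (x + a)) = (LINT x|lborel. f x)"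
    by (simp add: lborel_distr_plus add.commute)
qed

text \<open>
  The bridge between the two measures: questions about a Lebesgue measurable function are
  answered by any Borel function that agrees with it almost everywhere.
\<close>
lemma lebesgue_lborel_cong_AE:
  fixes f g :: "'a::euclidean_space \<Rightarrow> 'b::euclidean_space"
  assumes eq: "AE x in lborel. f x = g x" and g: "g \<in> borel_measurable borel"
  shows "f \<in> borel_measurable lebesgue"
    and "integrable lebesgue f \<longleftrightarrow> integrable lborel g"
    and "(LINT x|lebesgue. f x) = (LINT x|lborel. g x)"
proof -
  have g': "g \<in> borel_measurable lborel" using g by simp
  have eq': "AE x in lebesgue. g x = f x" using eq by (simp add: AE_completion_iff eq_commute)
  show f: "f \<in> borel_measurable lebesgue"
    by (rule borel_measurable_AE[OF measurable_completion[OF g'] eq'])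
  show "integrable lebesgue f \<longleftrightarrow> integrable lborel g"
    using integrable_cong_AE[OF f measurable_completion[OF g']] eq' integrable_completion[OF g'] by (simp add: eq_commute)
  show "(LINT x|lebesgue. f x) = (LINT x|lborel. g x)"
    using integral_cong_AE[OF f measurable_completion[OF g']] eq' integral_completion[OF g'] by (simp add: eq_commute)
qed

lemma
  fixes F :: "'a \<Rightarrow> real^'n^'m"
  assumes "integrable M F"
  shows integrable_matrix_component: "integrable M (\<lambda>x. F x $ i $ j)"
    and integral_matrix_component: "(LINT x|M. F x $ i $ j) = (LINT x|M. F x) $ i $ j"
proof -
  have "bounded_linear (\<lambda>A::real^'n^'m. A $ i $ j)"
    using bounded_linear_compose[OF bounded_linear_vec_nth bounded_linear_vec_nth] .
  then show "integrable M (\<lambda>x. F x $ i $ j)" "(LINT x|M. F x $ i $ j) = (LINT x|M. F x) $ i $ j"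
    using assms integrable_bounded_linear integral_bounded_linear by blast+
qed

section \<open>Integration by parts for Borel functions\<close>

text \<open>
  The part of the integrand that is homogeneous of degree \<open>0\<close> in \<open>h\<close>, and therefore bounded.
\<close>
definition nl_weight :: "real^'n \<Rightarrow> real^'n^'n" where
  "nl_weight h = (1 / (norm h)\<^sup>2) *\<^sub>R (outer h h - ((norm h)\<^sup>2 / (real CARD('n) + 2)) *\<^sub>R mat 1)"

lemma nl_hessian_integrand_eq:
  "nl_hessian_integrand r u x h = (second_diff u x h / (norm h)\<^sup>2 * r h) *\<^sub>R nl_weight h"
  by (simp add: nl_hessian_integrand_def nl_weight_def)

lemma borel_measurable_nl_weight [measurable]: "nl_weight \<in> borel_measurable borel"
proof -
  have [measurable]: "(\<lambda>h::real^'n. outer h h) \<in> borel_measurable borel"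
    unfolding outer_def by (intro borel_measurable_continuous_onI continuous_intros)
  show ?thesis unfolding nl_weight_def[abs_def] by measurable
qed

lemma nl_weight_bounded: "\<exists>c\<ge>0. \<forall>h::real^'n. norm (nl_weight h) \<le> c"
proof -
  have "\<bar>nl_weight h $ i $ j\<bar> \<le> 2" for h :: "real^'n" and i j
  proof (cases "h = 0")
    case False
    have "\<bar>h $ i * h $ j\<bar> \<le> (norm h)\<^sup>2"
      unfolding abs_mult power2_eq_square by (intro mult_mono component_le_norm_cart) auto
    then have 1: "\<bar>h $ i * h $ j / (norm h)\<^sup>2\<bar> \<le> 1" using False by simp
    have 2: "\<bar>(mat 1 :: real^'n^'n) $ i $ j / (real CARD('n) + 2)\<bar> \<le> 1" by (simp add: mat_def)
    have "nl_weight h $ i $ j = h $ i * h $ j / (norm h)\<^sup>2 - (mat 1 :: real^'n^'n) $ i $ j / (real CARD('n) + 2)"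
      using False by (simp add: nl_weight_def outer_def field_simps)
    then show ?thesis using 1 2 by linarith
  qed (simp add: nl_weight_def)
  then have "norm (nl_weight h) \<le> (\<Sum>i\<in>(UNIV::'n set). \<Sum>j\<in>(UNIV::'n set). 2)" for h :: "real^'n"
    unfolding norm_vec_def[of "nl_weight h"]
    by (intro order_trans[OF L2_set_le_sum] sum_mono order_trans[OF norm_le_l1_cart]) auto
  then show ?thesis by (intro exI[of _ "\<Sum>i\<in>(UNIV::'n set). \<Sum>j\<in>(UNIV::'n set). 2"]) auto
qed

lemma le_1_plus_powr:
  fixes a p :: real
  assumes "0 \<le> a" "1 \<le> p"
  shows "a \<le> 1 + a powr p"
proof (cases "a \<le> 1")
  case False
  then have "a powr 1 \<le> a powr p" using assms by (intro powr_mono) auto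
  then show ?thesis using assms by simp
qed (use powr_ge_zero[of a p] in linarith)

text \<open>
  This replaces Hoelder's inequality: an \<open>L\<^sup>p\<close> function is integrable over sets of finite measure,
  with a bound that depends on the set only through its measure.
\<close>
lemma abs_mult_indicator_le:
  fixes a p :: real
  assumes "1 \<le> p"
  shows "\<bar>a\<bar> * indicator B x \<le> indicator B x + \<bar>a\<bar> powr p"
  using le_1_plus_powr[of "\<bar>a\<bar>" p] assms by (auto simp: indicator_def)

lemma borel_measurable_nl_hessian_integrand:
  fixes v r :: "real^'n \<Rightarrow> real"
  assumes [measurable]: "r \<in> borel_measurable borel" "v \<in> borel_measurable borel"
  shows "(\<lambda>(x, h). nl_hessian_integrand r v x h) \<in> borel_measurable (lborel \<Otimes>\<^sub>M lborel)"
    and "nl_hessian_integrand r v x \<in> borel_measurable borel"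
  unfolding nl_hessian_integrand_eq second_diff_def by measurable

lemma nl_hessian_lborel:
  fixes v r :: "real^'n \<Rightarrow> real"
  assumes "r \<in> borel_measurable borel" "v \<in> borel_measurable borel"
  shows "nl_hessian r v x = (real CARD('n) * (real CARD('n) + 2) / 2) *\<^sub>R
       (LINT h|lborel. nl_hessian_integrand r v x h)"
  unfolding nl_hessian_def
  using integral_completion[of "nl_hessian_integrand r v x" lborel]
    borel_measurable_nl_hessian_integrand(2)[OF assms, of x] by simp

lemma nl_hessian_integrand_test_le:
  fixes \<phi> r :: "real^'n \<Rightarrow> real"
  assumes r0: "\<And>h. 0 \<le> r h" and \<phi>: "C_c_k 2 \<phi>"
  obtains B C where "compact B" "0 \<le> C" "\<And>x h. norm (nl_hessian_integrand r \<phi> x h)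
      \<le> C * (indicator B x + indicator B (x + h) + indicator B (x - h)) * r h"
proof -
  have ck: "C_k 2 \<phi>" using \<phi> by (auto simp: C_c_k_def)
  obtain B where B: "compact B" and 0: "\<And>x. x \<notin> B \<Longrightarrow> \<phi> x = 0"
    using C_c_k_support[OF \<phi>] by metis
  obtain C where C: "0 \<le> C" "\<And>x h. \<bar>second_diff \<phi> x h\<bar>
      \<le> C * (norm h)\<^sup>2 * (indicator B x + indicator B (x + h) + indicator B (x - h))"
    using second_diff_le_square_on_support[OF ck B 0] by blast
  obtain c where c: "0 \<le> c" "\<And>h::real^'n. norm (nl_weight h) \<le> c"
    using nl_weight_bounded by blast
  have "norm (nl_hessian_integrand r \<phi> x h)
      \<le> (C * c) * (indicator B x + indicator B (x + h) + indicator B (x - h)) * r h" for x h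
  proof -
    define b where "b = (indicator B x + indicator B (x + h) + indicator B (x - h) :: real)"
    have b: "0 \<le> b" by (simp add: b_def)
    have "\<bar>second_diff \<phi> x h\<bar> / (norm h)\<^sup>2 \<le> C * b"
      using C(2)[of x h, folded b_def] C(1) b by (cases "h = 0") (auto simp: field_simps)
    then have "\<bar>second_diff \<phi> x h\<bar> / (norm h)\<^sup>2 * r h * norm (nl_weight h) \<le> C * b * r h * c"
      using r0 c C(1) b by (intro mult_mono mult_right_mono mult_nonneg_nonneg) auto
    then show ?thesis
      using r0[of h] by (simp add: nl_hessian_integrand_eq abs_mult b_def mult_ac)
  qed
  then show thesis using C(1) c(1) by (intro that[OF B, of "C * c"]) auto
qed

lemma integrable_nl_hessian_integrand_test:
  fixes \<phi> r :: "real^'n \<Rightarrow> real"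
  assumes r [measurable]: "r \<in> borel_measurable borel"
    and r0: "\<And>h. 0 \<le> r h" and ri: "integrable lborel r" and \<phi>: "C_c_k 2 \<phi>"
  shows "integrable lborel (nl_hessian_integrand r \<phi> x)"
proof -
  obtain B C where B: "compact B" and C: "0 \<le> C" "\<And>x h. norm (nl_hessian_integrand r \<phi> x h)
      \<le> C * (indicator B x + indicator B (x + h) + indicator B (x - h)) * r h"
    by (rule nl_hessian_integrand_test_le[of r \<phi>, OF r0 \<phi>], rule that)
  note \<phi>m [measurable] = borel_measurable_C_c_k[OF \<phi>]
  show ?thesis
  proof (rule Bochner_Integration.integrable_bound[where f = "\<lambda>h. C * 3 * r h"])
    show "AE h in lborel. norm (nl_hessian_integrand r \<phi> x h) \<le> norm (C * 3 * r h)"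
    proof (intro AE_I2)
      fix h
      have "C * (indicator B x + indicator B (x + h) + indicator B (x - h)) * r h \<le> C * 3 * r h"
        using C(1) r0 by (intro mult_right_mono mult_left_mono) (auto simp: indicator_def)
      with C(2)[of x h] C(1) r0[of h] show "norm (nl_hessian_integrand r \<phi> x h) \<le> norm (C * 3 * r h)"
        by (simp add: abs_mult)
    qed
  qed (use ri borel_measurable_nl_hessian_integrand(2)[OF r \<phi>m] in auto)
qed

text \<open>
  The integral over \<open>x\<close> of the right-hand side of \<open>abs_mult_indicator_le\<close> is the same for all
  translates of \<open>B\<close>, so it is the integral over \<open>x\<close>, with \<open>h\<close> fixed, that has to be taken
  first; what remains is a constant times the integral of \<open>r\<close>.
\<close>
lemma integrable_Lp_mult_kernel:
  fixes u r :: "real^'n \<Rightarrow> real" and p :: real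
  assumes u [measurable]: "u \<in> borel_measurable borel"
    and p: "1 \<le> p" and up: "integrable lborel (\<lambda>x. \<bar>u x\<bar> powr p)"
    and r [measurable]: "r \<in> borel_measurable borel"
    and r0: "\<And>h. 0 \<le> r h" and ri: "integrable lborel r"
    and B: "compact B"
  shows "integrable (lborel \<Otimes>\<^sub>M lborel)
     (\<lambda>(x, h). \<bar>u x\<bar> * (indicator B x + indicator B (x + h) + indicator B (x - h)) * r h)"
proof -
  have [measurable]: "B \<in> sets borel" using B borel_closed compact_imp_closed by blast
  have Bi: "integrable lborel (indicator B :: real^'n \<Rightarrow> real)"
    using B emeasure_bounded_finite[OF compact_imp_bounded, of B] by (simp add: integrable_indicator_iff)
  have Bm [measurable]: "(indicator B :: real^'n \<Rightarrow> real) \<in> borel_measurable borel" by simp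
  define P where "P = (LINT x|lborel. \<bar>u x\<bar> powr p)"
  define b where "b = measure lborel B"
  \<comment> \<open>The arguments are swapped so that Fubini's theorem integrates over \<open>x\<close> first.\<close>
  define G :: "(real^'n) \<times> (real^'n) \<Rightarrow> real" where
    "G = (\<lambda>(h, x). r h * (indicator B x + indicator B (x + h) + indicator B (x + (- h)) + 3 * \<bar>u x\<bar> powr p))"
  have Bt: "integrable lborel (\<lambda>x. indicator B (x + k) :: real)" "(LINT x|lborel. (indicator B (x + k) :: real)) = b" for k
    using Bi lborel_translate[OF Bm, of k] by (auto simp: b_def)
  have Gi: "integrable lborel (\<lambda>x. G (h, x))" "(LINT x|lborel. G (h, x)) = r h * (3 * b + 3 * P)" for h
    using Bt[of h] Bt[of "- h"] Bi up unfolding G_def by (auto simp: P_def b_def)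
  have G0: "0 \<le> G (h, x)" for h x using r0 by (auto simp: G_def)
  have "integrable (lborel \<Otimes>\<^sub>M lborel) G"
  proof (rule lborel_pair.Fubini_integrable)
    show "G \<in> borel_measurable (lborel \<Otimes>\<^sub>M lborel)" unfolding G_def by measurable
    show "integrable lborel (\<lambda>h. LINT x|lborel. norm (G (h, x)))"
      using G0 ri by (simp add: Gi)
  qed (use Gi in auto)
  then have "integrable (lborel \<Otimes>\<^sub>M lborel) (\<lambda>(x, h). G (h, x))"
    by (rule lborel_pair.integrable_product_swap)
  then show ?thesis
  proof (rule Bochner_Integration.integrable_bound)
    show "(\<lambda>(x, h). \<bar>u x\<bar> * (indicator B x + indicator B (x + h) + indicator B (x - h)) * r h)
       \<in> borel_measurable (lborel \<Otimes>\<^sub>M lborel)" by measurable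
    have "\<bar>u x\<bar> * (indicator B x + indicator B (x + h) + indicator B (x - h)) * r h \<le> G (h, x)" for x h
    proof -
      have "\<bar>u x\<bar> * (indicator B x + indicator B (x + h) + indicator B (x - h))
          \<le> indicator B x + indicator B (x + h) + indicator B (x + (- h)) + 3 * \<bar>u x\<bar> powr p"
        using abs_mult_indicator_le[OF p, of "u x" B x] abs_mult_indicator_le[OF p, of "u x" B "x + h"]
          abs_mult_indicator_le[OF p, of "u x" B "x + (- h)"] by (simp add: distrib_left)
      from mult_right_mono[OF this r0[of h]] show ?thesis by (simp add: G_def mult_ac)
    qed
    then show "AE z in lborel \<Otimes>\<^sub>M lborel.
      norm (case z of (x, h) \<Rightarrow> \<bar>u x\<bar> * (indicator B x + indicator B (x + h) + indicator B (x - h)) * r h)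
      \<le> norm (case z of (x, h) \<Rightarrow> G (h, x))"
      using r0 G0 by (intro AE_I2) (auto simp: abs_mult)
  qed
qed

lemma integrable_Lp_mult_nl_hessian_integrand_test:
  fixes u r \<phi> :: "real^'n \<Rightarrow> real" and p :: real
  assumes u [measurable]: "u \<in> borel_measurable borel"
    and p: "1 \<le> p" and up: "integrable lborel (\<lambda>x. \<bar>u x\<bar> powr p)"
    and r [measurable]: "r \<in> borel_measurable borel"
    and r0: "\<And>h. 0 \<le> r h" and ri: "integrable lborel r"
    and \<phi>: "C_c_k 2 \<phi>"
  shows "integrable (lborel \<Otimes>\<^sub>M lborel) (\<lambda>(x, h). u x *\<^sub>R nl_hessian_integrand r \<phi> x h)"
proof -
  obtain B C where B: "compact B" and C: "0 \<le> C" "\<And>x h. norm (nl_hessian_integrand r \<phi> x h)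
      \<le> C * (indicator B x + indicator B (x + h) + indicator B (x - h)) * r h"
    by (rule nl_hessian_integrand_test_le[of r \<phi>, OF r0 \<phi>], rule that)
  note \<phi>m [measurable] = borel_measurable_C_c_k[OF \<phi>]
  note [measurable] = borel_measurable_nl_hessian_integrand(1)[OF r \<phi>m, unfolded case_prod_beta]
  show ?thesis
  proof (rule Bochner_Integration.integrable_bound[OF integrable_mult_right[OF integrable_Lp_mult_kernel[OF u p up r r0 ri B], of C]])
    show "(\<lambda>(x, h). u x *\<^sub>R nl_hessian_integrand r \<phi> x h) \<in> borel_measurable (lborel \<Otimes>\<^sub>M lborel)"
      unfolding case_prod_beta by measurable
    show "AE z in lborel \<Otimes>\<^sub>M lborel. norm (case z of (x, h) \<Rightarrow> u x *\<^sub>R nl_hessian_integrand r \<phi> x h)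
      \<le> norm (C * (case z of (x, h) \<Rightarrow> \<bar>u x\<bar> * (indicator B x + indicator B (x + h) + indicator B (x - h)) * r h))"
      using mult_left_mono[OF C(2) abs_ge_zero[of "u _"]] C(1) r0
      by (intro AE_I2) (auto simp: abs_mult mult_ac)
  qed
qed

text \<open>
  Each of the three products is integrable by itself, because \<open>\<phi>\<close> is bounded with compact support
  and \<open>u\<close> is locally integrable. The sum can therefore be split and the two outer
  products translated by \<open>h\<close> and \<open>- h\<close>.
\<close>
lemma second_diff_symmetric:
  fixes u \<phi> :: "real^'n \<Rightarrow> real" and p :: real
  assumes u [measurable]: "u \<in> borel_measurable borel"
    and p: "1 \<le> p" and up: "integrable lborel (\<lambda>x. \<bar>u x\<bar> powr p)"
    and \<phi>: "C_c_k k \<phi>"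
  shows "integrable lborel (\<lambda>x. u x * second_diff \<phi> x h)"
    and "integrable lborel (\<lambda>x. \<phi> x * second_diff u x h)"
    and "(LINT x|lborel. u x * second_diff \<phi> x h) = (LINT x|lborel. \<phi> x * second_diff u x h)"
proof -
  obtain B M where B: "compact B" "\<And>x. x \<notin> B \<Longrightarrow> \<phi> x = 0"
    and M: "0 \<le> M" "\<And>x. \<bar>\<phi> x\<bar> \<le> M"
    by (rule C_c_k_support[OF \<phi>], rule that)
  note \<phi>m [measurable] = borel_measurable_C_c_k[OF \<phi>]
  have [measurable]: "B \<in> sets borel" using B borel_closed compact_imp_closed by blast
  have Bi: "integrable lborel (indicator B :: real^'n \<Rightarrow> real)"
    using B emeasure_bounded_finite[OF compact_imp_bounded, of B] by (simp add: integrable_indicator_iff)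
  have Bm [measurable]: "(indicator B :: real^'n \<Rightarrow> real) \<in> borel_measurable borel" by simp
  have i: "integrable lborel (\<lambda>x. u x * \<phi> (x + k))" for k
  proof (rule Bochner_Integration.integrable_bound[where f = "\<lambda>x. M * (indicator B (x + k) + \<bar>u x\<bar> powr p)"])
    show "integrable lborel (\<lambda>x. M * (indicator B (x + k) + \<bar>u x\<bar> powr p))"
      using Bi up lborel_translate(1)[OF Bm, of k] by auto
    show "AE x in lborel. norm (u x * \<phi> (x + k)) \<le> norm (M * (indicator B (x + k) + \<bar>u x\<bar> powr p))"
    proof (intro AE_I2)
      fix x
      have "\<bar>\<phi> (x + k)\<bar> \<le> M * indicator B (x + k)" using B(2) M by (auto simp: indicator_def)
      from mult_left_mono[OF this abs_ge_zero[of "u x"]]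
      have "\<bar>u x * \<phi> (x + k)\<bar> \<le> M * (\<bar>u x\<bar> * indicator B (x + k))" by (simp add: abs_mult mult_ac)
      also have "\<dots> \<le> M * (indicator B (x + k) + \<bar>u x\<bar> powr p)"
        using M(1) abs_mult_indicator_le[OF p] by (intro mult_left_mono)
      finally show "norm (u x * \<phi> (x + k)) \<le> norm (M * (indicator B (x + k) + \<bar>u x\<bar> powr p))" by simp
    qed
  qed simp
  have t: "integrable lborel (\<lambda>x. \<phi> x * u (x - k))"
    "(LINT x|lborel. \<phi> x * u (x - k)) = (LINT x|lborel. u x * \<phi> (x + k))" for k
    using lborel_translate[of "\<lambda>x. \<phi> x * u (x - k)" k] i[of k] by (auto simp: mult.commute)
  note i3 = i[of h] i[of 0, simplified] i[of "- h", simplified]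
  note t3 = t[of h] t[of 0, simplified] t[of "- h", simplified]
  have eq: "u x * second_diff \<phi> x h = u x * \<phi> (x + h) - 2 * (u x * \<phi> x) + u x * \<phi> (x - h)"
    "\<phi> x * second_diff u x h = \<phi> x * u (x - h) - 2 * (\<phi> x * u x) + \<phi> x * u (x + h)" for x
    by (simp_all add: second_diff_def algebra_simps)
  show "integrable lborel (\<lambda>x. u x * second_diff \<phi> x h)"
    "integrable lborel (\<lambda>x. \<phi> x * second_diff u x h)"
    unfolding eq using i3 t3 by simp_all
  show "(LINT x|lborel. u x * second_diff \<phi> x h) = (LINT x|lborel. \<phi> x * second_diff u x h)"
    unfolding eq using i3 t3 by simp
qed

lemma integrable_nl_hessian_integrand:
  fixes u r :: "real^'n \<Rightarrow> real"
  assumes u: "u \<in> borel_measurable borel" and r: "r \<in> borel_measurable borel"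
    and r0: "\<And>h. 0 \<le> r h"
    and hyp: "integrable (lborel \<Otimes>\<^sub>M lborel) (\<lambda>(x, h). \<bar>second_diff u x h\<bar> / (norm h)\<^sup>2 * r h)"
  shows "integrable (lborel \<Otimes>\<^sub>M lborel) (\<lambda>(x, h). nl_hessian_integrand r u x h)"
proof -
  obtain c where c: "0 \<le> c" "\<And>h::real^'n. norm (nl_weight h) \<le> c" using nl_weight_bounded by blast
  have *: "norm (nl_hessian_integrand r u x h) \<le> c * (\<bar>second_diff u x h\<bar> / (norm h)\<^sup>2 * r h)" for x h
    using mult_right_mono[OF c(2), of "\<bar>second_diff u x h\<bar> / (norm h)\<^sup>2 * r h" h] r0[of h]
    by (simp add: nl_hessian_integrand_eq abs_mult mult_ac)
  show ?thesis
  proof (rule Bochner_Integration.integrable_bound[OF integrable_mult_right[OF hyp, of c]])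
    show "(\<lambda>(x, h). nl_hessian_integrand r u x h) \<in> borel_measurable (lborel \<Otimes>\<^sub>M lborel)"
      by (rule borel_measurable_nl_hessian_integrand(1)[OF r u])
    show "AE z in lborel \<Otimes>\<^sub>M lborel. norm (case z of (x, h) \<Rightarrow> nl_hessian_integrand r u x h)
      \<le> norm (c * (case z of (x, h) \<Rightarrow> \<bar>second_diff u x h\<bar> / (norm h)\<^sup>2 * r h))"
      using * c(1) r0 by (intro AE_I2) (auto simp: abs_mult)
  qed
qed

lemma AE_integrable_nl_hessian_integrand:
  fixes u r :: "real^'n \<Rightarrow> real"
  assumes u: "u \<in> borel_measurable borel" and r: "r \<in> borel_measurable borel"
    and r0: "\<And>h. 0 \<le> r h"
    and hyp: "integrable (lborel \<Otimes>\<^sub>M lborel) (\<lambda>(x, h). \<bar>second_diff u x h\<bar> / (norm h)\<^sup>2 * r h)"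
  shows "AE x in lborel. integrable lborel (nl_hessian_integrand r u x)"
  using lborel_pair.AE_integrable_fst'[OF integrable_nl_hessian_integrand[OF u r r0 hyp]] by simp

lemma integrable_nl_hessian:
  fixes u r :: "real^'n \<Rightarrow> real"
  assumes u: "u \<in> borel_measurable borel" and r: "r \<in> borel_measurable borel"
    and r0: "\<And>h. 0 \<le> r h"
    and hyp: "integrable (lborel \<Otimes>\<^sub>M lborel) (\<lambda>(x, h). \<bar>second_diff u x h\<bar> / (norm h)\<^sup>2 * r h)"
  shows "integrable lborel (nl_hessian r u)"
  using lborel_pair.integrable_fst'[OF integrable_nl_hessian_integrand[OF u r r0 hyp]]
  unfolding nl_hessian_lborel[OF r u, abs_def] by simp

text \<open>
  The Hessians are treated as matrix-valued integrals; components are taken only in the final theorem.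
\<close>
lemma nl_hessian_integration_by_parts:
  fixes u r \<phi> :: "real^'n \<Rightarrow> real" and p :: real
  assumes u [measurable]: "u \<in> borel_measurable borel"
    and p: "1 \<le> p" and up: "integrable lborel (\<lambda>x. \<bar>u x\<bar> powr p)"
    and r [measurable]: "r \<in> borel_measurable borel"
    and r0: "\<And>h. 0 \<le> r h" and ri: "integrable lborel r"
    and \<phi>: "C_c_k 2 \<phi>"
    and hyp: "integrable (lborel \<Otimes>\<^sub>M lborel) (\<lambda>(x, h). \<bar>second_diff u x h\<bar> / (norm h)\<^sup>2 * r h)"
  shows "integrable lborel (\<lambda>x. u x *\<^sub>R nl_hessian r \<phi> x)"
    and "integrable lborel (\<lambda>x. \<phi> x *\<^sub>R nl_hessian r u x)"
    and "(LINT x|lborel. u x *\<^sub>R nl_hessian r \<phi> x) = (LINT x|lborel. \<phi> x *\<^sub>R nl_hessian r u x)"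
proof -
  obtain B M where B: "compact B" "\<And>x. x \<notin> B \<Longrightarrow> \<phi> x = 0"
    and M: "0 \<le> M" "\<And>x. \<bar>\<phi> x\<bar> \<le> M"
    by (rule C_c_k_support[OF \<phi>], rule that)
  note \<phi>m [measurable] = borel_measurable_C_c_k[OF \<phi>]
  define a where "a = real CARD('n) * (real CARD('n) + 2) / 2"
  have H: "nl_hessian r v x = a *\<^sub>R (LINT h|lborel. nl_hessian_integrand r v x h)"
    if "v \<in> borel_measurable borel" for v x
    using nl_hessian_lborel[OF r that] by (simp add: a_def)
  note 1 = integrable_Lp_mult_nl_hessian_integrand_test[OF u p up r r0 ri \<phi>]
  note [measurable] = borel_measurable_nl_hessian_integrand(1)[OF r u, unfolded case_prod_beta]
  have 2: "integrable (lborel \<Otimes>\<^sub>M lborel) (\<lambda>(x, h). \<phi> x *\<^sub>R nl_hessian_integrand r u x h)"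
  proof (rule Bochner_Integration.integrable_bound[OF integrable_scaleR_right[OF integrable_nl_hessian_integrand[OF u r r0 hyp], of M]])
    show "(\<lambda>(x, h). \<phi> x *\<^sub>R nl_hessian_integrand r u x h) \<in> borel_measurable (lborel \<Otimes>\<^sub>M lborel)"
      unfolding case_prod_beta by measurable
  qed (use M in \<open>auto intro!: AE_I2 mult_right_mono\<close>)
  have eq1: "u x *\<^sub>R nl_hessian r \<phi> x = a *\<^sub>R (LINT h|lborel. u x *\<^sub>R nl_hessian_integrand r \<phi> x h)" for x
    by (simp add: H[OF \<phi>m] mult.commute)
  have eq2: "\<phi> x *\<^sub>R nl_hessian r u x = a *\<^sub>R (LINT h|lborel. \<phi> x *\<^sub>R nl_hessian_integrand r u x h)" for x
    by (simp add: H[OF u] mult.commute)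
  show "integrable lborel (\<lambda>x. u x *\<^sub>R nl_hessian r \<phi> x)"
    unfolding eq1 by (intro integrable_scaleR_right) (use lborel_pair.integrable_fst'[OF 1] in simp)
  show "integrable lborel (\<lambda>x. \<phi> x *\<^sub>R nl_hessian r u x)"
    unfolding eq2 by (intro integrable_scaleR_right) (use lborel_pair.integrable_fst'[OF 2] in simp)
  \<comment> \<open>For fixed \<open>h\<close> the weight is a constant matrix, and the symmetry of the second difference applies.\<close>
  have inner: "(LINT x|lborel. u x *\<^sub>R nl_hessian_integrand r \<phi> x h)
      = (LINT x|lborel. \<phi> x *\<^sub>R nl_hessian_integrand r u x h)" for h
  proof -
    have "v x *\<^sub>R nl_hessian_integrand r w x h = (v x * second_diff w x h) *\<^sub>R ((r h / (norm h)\<^sup>2) *\<^sub>R nl_weight h)"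
      for v w :: "real^'n \<Rightarrow> real" and x
      by (simp add: nl_hessian_integrand_eq)
    then show ?thesis
      using second_diff_symmetric[OF u p up \<phi>, of h] by (simp only: integral_scaleR_left)
  qed
  have "(LINT x|lborel. u x *\<^sub>R nl_hessian r \<phi> x)
      = a *\<^sub>R (LINT x|lborel. LINT h|lborel. u x *\<^sub>R nl_hessian_integrand r \<phi> x h)"
    unfolding eq1 by (rule integral_scaleR_right)
  also have "\<dots> = a *\<^sub>R (LINT h|lborel. LINT x|lborel. u x *\<^sub>R nl_hessian_integrand r \<phi> x h)"
    using lborel_pair.Fubini_integral[OF 1] by simp
  also have "\<dots> = a *\<^sub>R (LINT x|lborel. LINT h|lborel. \<phi> x *\<^sub>R nl_hessian_integrand r u x h)"
    using lborel_pair.Fubini_integral[OF 2] by (simp add: inner)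
  also have "\<dots> = (LINT x|lborel. \<phi> x *\<^sub>R nl_hessian r u x)"
    unfolding eq2 by (rule integral_scaleR_right[symmetric])
  finally show "(LINT x|lborel. u x *\<^sub>R nl_hessian r \<phi> x) = (LINT x|lborel. \<phi> x *\<^sub>R nl_hessian r u x)" .
qed

section \<open>Passing to Lebesgue measurable functions\<close>

text \<open>
  The value at the centre \<open>x\<close> enters for every \<open>h\<close>, so agreement at the point \<open>x\<close> has to be assumed
  separately. For a test function it holds at every point, for \<open>u\<close> at almost every one.
\<close>
lemma nl_hessian_integrand_cong_AE:
  fixes r r' v v' :: "real^'n \<Rightarrow> real"
  assumes r: "AE h in lborel. r h = r' h" and v: "AE y in lborel. v y = v' y" and x: "v x = v' x"
  shows "AE h in lborel. nl_hessian_integrand r v x h = nl_hessian_integrand r' v' x h"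
  using r AE_lborel_translate[OF v, of x] AE_lborel_reflect[OF v, of x]
  by eventually_elim (simp add: nl_hessian_integrand_def second_diff_def x)

lemma
  fixes r r' v v' :: "real^'n \<Rightarrow> real"
  assumes r: "AE h in lborel. r h = r' h" and v: "AE y in lborel. v y = v' y" and x: "v x = v' x"
    and borel: "r' \<in> borel_measurable borel" "v' \<in> borel_measurable borel"
  shows nl_hessian_cong_AE: "nl_hessian r v x = nl_hessian r' v' x"
    and nl_hessian_exists_cong_AE: "nl_hessian_exists r v x \<longleftrightarrow> integrable lborel (nl_hessian_integrand r' v' x)"
proof -
  note m = borel_measurable_nl_hessian_integrand(2)[OF borel, of x]
  have "AE h in lborel. nl_hessian_integrand r' v' x h = nl_hessian_integrand r' v' x h" by simp
  note * = lebesgue_lborel_cong_AE(2,3)[OF nl_hessian_integrand_cong_AE[OF r v x] m]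
    lebesgue_lborel_cong_AE(3)[OF this m]
  show "nl_hessian r v x = nl_hessian r' v' x"
    unfolding nl_hessian_def using * by simp
  show "nl_hessian_exists r v x \<longleftrightarrow> integrable lborel (nl_hessian_integrand r' v' x)"
    unfolding nl_hessian_exists_def using * by simp
qed

text \<open>
  The exceptional set is covered by a Borel set of pairs whose sections over almost all \<open>x\<close> are
  unions of translated and reflected null sets, hence null.
\<close>
lemma integrable_second_diff_quotient_lborel:
  fixes r r' u u' :: "real^'n \<Rightarrow> real"
  assumes r: "AE h in lborel. r h = r' h" and u: "AE y in lborel. u y = u' y"
    and borel [measurable]: "r' \<in> borel_measurable borel" "u' \<in> borel_measurable borel"
    and int: "integrable (lebesgue :: ((real^'n) \<times> (real^'n)) measure)
           (\<lambda>(x, h). \<bar>second_diff u x h\<bar> / (norm h)\<^sup>2 * r h)"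
  shows "integrable (lborel \<Otimes>\<^sub>M lborel) (\<lambda>(x, h). \<bar>second_diff u' x h\<bar> / (norm h)\<^sup>2 * r' h)"
proof -
  obtain N where N: "{y. u y \<noteq> u' y} \<subseteq> N" "N \<in> null_sets lborel"
    using u by (auto simp: eventually_ae_filter)
  obtain R where R: "{h. r h \<noteq> r' h} \<subseteq> R" "R \<in> null_sets lborel"
    using r by (auto simp: eventually_ae_filter)
  have [measurable]: "N \<in> sets borel" "R \<in> sets borel" using N(2) R(2) by (auto dest: null_setsD2)
  \<comment> \<open>Borel supersets of the exceptional sets make \<open>Q\<close> measurable in the product, as Fubini's theorem requires.\<close>
  define Q :: "(real^'n) \<times> (real^'n) \<Rightarrow> bool" where
    "Q z \<longleftrightarrow> fst z \<notin> N \<and> fst z + snd z \<notin> N \<and> fst z - snd z \<notin> N \<and> snd z \<notin> R" for z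
  have "AE z in lborel \<Otimes>\<^sub>M lborel. Q z"
  proof (rule lborel_pair.AE_pair_measure)
    show "{z \<in> space (lborel \<Otimes>\<^sub>M lborel). Q z} \<in> sets (lborel \<Otimes>\<^sub>M lborel)"
      unfolding Q_def by measurable
    have "AE h in lborel. Q (x, h)" if "x \<notin> N" for x
      using AE_lborel_translate[OF AE_not_in[OF N(2)], of x] AE_lborel_reflect[OF AE_not_in[OF N(2)], of x]
        AE_not_in[OF R(2)]
      by eventually_elim (simp add: Q_def that)
    then show "AE x in lborel. AE h in lborel. Q (x, h)"
      using AE_not_in[OF N(2)] by (rule eventually_mono[rotated])
  qed
  then have "AE z in lborel. Q z" by (simp only: lborel_prod)
  then have eq: "AE z in lborel. (case z of (x, h) \<Rightarrow> \<bar>second_diff u x h\<bar> / (norm h)\<^sup>2 * r h)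
      = (case z of (x, h) \<Rightarrow> \<bar>second_diff u' x h\<bar> / (norm h)\<^sup>2 * r' h)"
  proof (rule eventually_mono)
    fix z assume "Q z"
    then have "u (fst z) = u' (fst z)" "u (fst z + snd z) = u' (fst z + snd z)"
      "u (fst z - snd z) = u' (fst z - snd z)" "r (snd z) = r' (snd z)"
      using N(1) R(1) unfolding Q_def by blast+
    then show "(case z of (x, h) \<Rightarrow> \<bar>second_diff u x h\<bar> / (norm h)\<^sup>2 * r h)
      = (case z of (x, h) \<Rightarrow> \<bar>second_diff u' x h\<bar> / (norm h)\<^sup>2 * r' h)"
      by (simp add: second_diff_def split_beta)
  qed
  have "(\<lambda>(x, h). \<bar>second_diff u' x h\<bar> / (norm h)\<^sup>2 * r' h) \<in> borel_measurable (lborel \<Otimes>\<^sub>M lborel)"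
    unfolding second_diff_def by measurable
  then have m: "(\<lambda>(x, h). \<bar>second_diff u' x h\<bar> / (norm h)\<^sup>2 * r' h) \<in> borel_measurable borel"
    by (simp only: lborel_prod measurable_lborel2)
  show ?thesis
    using lebesgue_lborel_cong_AE(2)[OF eq m] int by (simp only: lborel_prod)
qed

theorem theorem1p3:
  fixes \<rho> :: "nat \<Rightarrow> real^'n \<Rightarrow> real" and n :: nat
    and u :: "real^'n \<Rightarrow> real" and p :: real
  assumes "radial_kernels \<rho>"
    and "1 \<le> p" and "in_Lp p u"
    and "integrable (lebesgue :: ((real^'n) \<times> (real^'n)) measure)
           (\<lambda>(x, h). \<bar>second_diff u x h\<bar> / (norm h)\<^sup>2 * \<rho> n h)"
  shows "(\<exists>V. represents_dist_nl_hessian (\<rho> n) u V) \<and>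
    (\<forall>\<phi> i j. C_c_k 2 \<phi> \<longrightarrow>
       (\<forall>x. nl_hessian_exists (\<rho> n) \<phi> x) \<and>
       integrable lebesgue (\<lambda>x. u x * nl_hessian (\<rho> n) \<phi> x $ i $ j) \<and>
       integrable lebesgue (\<lambda>x. nl_hessian (\<rho> n) u x $ i $ j * \<phi> x) \<and>
       dist_nl_hessian (\<rho> n) u i j \<phi> =
         (LINT x|lebesgue. nl_hessian (\<rho> n) u x $ i $ j * \<phi> x)) \<and>
    (AE x in lebesgue. nl_hessian_exists (\<rho> n) u x) \<and>
    (\<forall>V. represents_dist_nl_hessian (\<rho> n) u V \<longrightarrow>
       (AE x in lebesgue. nl_hessian (\<rho> n) u x = V x))"
proof -
  define r where "r = \<rho> n"
  have r: "\<And>h. 0 \<le> r h" "integrable lebesgue r"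
    using assms(1) unfolding radial_kernels_def r_def by blast+
  have u: "u \<in> borel_measurable lebesgue" "integrable lebesgue (\<lambda>x. \<bar>u x\<bar> powr p)"
    using assms(3) by (auto simp: in_Lp_def)
  obtain s where s: "s \<in> borel_measurable lborel" "AE h in lborel. r h = s h"
    using completion_ex_borel_measurable_real[OF borel_measurable_integrable[OF r(2)]] by blast
  \<comment> \<open>A Borel representative may be negative on a null set; the absolute value repairs this.\<close>
  define r' where "r' h = \<bar>s h\<bar>" for h
  have r': "r' \<in> borel_measurable borel" "\<And>h. 0 \<le> r' h"
    using s(1) by (auto simp: r'_def[abs_def])
  have rr': "AE h in lborel. r h = r' h"
    using s(2) by eventually_elim (metis abs_of_nonneg r(1) r'_def)
  have ri': "integrable lborel r'" using lebesgue_lborel_cong_AE(2)[OF rr' r'(1)] r(2) by simp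
  obtain u' where u': "u' \<in> borel_measurable borel" and uu': "AE x in lborel. u x = u' x"
    using completion_ex_borel_measurable_real[OF u(1)] by auto
  have up': "integrable lborel (\<lambda>x. \<bar>u' x\<bar> powr p)"
  proof -
    have eq: "AE x in lborel. \<bar>u x\<bar> powr p = \<bar>u' x\<bar> powr p" using uu' by eventually_elim simp
    have m: "(\<lambda>x. \<bar>u' x\<bar> powr p) \<in> borel_measurable borel" using u' by simp
    show ?thesis using lebesgue_lborel_cong_AE(2)[OF eq m] u(2) by simp
  qed
  have hyp': "integrable (lborel \<Otimes>\<^sub>M lborel) (\<lambda>(x, h). \<bar>second_diff u' x h\<bar> / (norm h)\<^sup>2 * r' h)"
    using integrable_second_diff_quotient_lborel[OF rr' uu' r'(1) u'] assms(4) by (simp add: r_def)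
  note parts = nl_hessian_integration_by_parts[OF u' assms(2) up' r' ri' _ hyp']

  have Hu: "AE x in lborel. nl_hessian r u x = nl_hessian r' u' x"
    using uu' by eventually_elim (rule nl_hessian_cong_AE[OF rr' uu' _ r'(1) u'])
  have Hui': "integrable lborel (nl_hessian r' u')" by (rule integrable_nl_hessian[OF u' r' hyp'])
  have Hui: "integrable lebesgue (nl_hessian r u)"
    using lebesgue_lborel_cong_AE(2)[OF Hu] Hui' by auto
  have ex: "AE x in lebesgue. nl_hessian_exists r u x"
  proof -
    have "AE x in lborel. nl_hessian_exists r u x"
      using uu' AE_integrable_nl_hessian_integrand[OF u' r' hyp']
      by eventually_elim (simp add: nl_hessian_exists_cong_AE[OF rr' uu' _ r'(1) u'])
    then show ?thesis by (rule AE_completion)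
  qed

  have test: "(\<forall>x. nl_hessian_exists r \<phi> x) \<and>
       integrable lebesgue (\<lambda>x. u x * nl_hessian r \<phi> x $ i $ j) \<and>
       integrable lebesgue (\<lambda>x. nl_hessian r u x $ i $ j * \<phi> x) \<and>
       dist_nl_hessian r u i j \<phi> = (LINT x|lebesgue. nl_hessian r u x $ i $ j * \<phi> x)"
    if \<phi>: "C_c_k 2 \<phi>" for \<phi> i j
  proof -
    note \<phi>m = borel_measurable_C_c_k[OF \<phi>]
    have H\<phi>: "nl_hessian r \<phi> x = nl_hessian r' \<phi> x" for x
      by (rule nl_hessian_cong_AE[OF rr' _ refl r'(1) \<phi>m]) simp
    have "nl_hessian_exists r \<phi> x \<longleftrightarrow> integrable lborel (nl_hessian_integrand r' \<phi> x)" for x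
      by (rule nl_hessian_exists_cong_AE[OF rr' _ refl r'(1) \<phi>m]) simp
    then have ex\<phi>: "nl_hessian_exists r \<phi> x" for x
      using integrable_nl_hessian_integrand_test[OF r' ri' \<phi>] by blast
    note p = parts[OF \<phi>]
    let ?f' = "\<lambda>x. (u' x *\<^sub>R nl_hessian r' \<phi> x) $ i $ j"
    let ?g' = "\<lambda>x. (\<phi> x *\<^sub>R nl_hessian r' u' x) $ i $ j"
    have f'i: "integrable lborel ?f'" by (rule integrable_matrix_component[OF p(1)])
    have g'i: "integrable lborel ?g'" by (rule integrable_matrix_component[OF p(2)])
    have "AE x in lborel. u x * nl_hessian r \<phi> x $ i $ j = ?f' x"
      using uu' by eventually_elim (simp add: H\<phi>)
    note f = lebesgue_lborel_cong_AE(2,3)[OF this]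
    have "AE x in lborel. nl_hessian r u x $ i $ j * \<phi> x = ?g' x"
      using Hu by eventually_elim simp
    note g = lebesgue_lborel_cong_AE(2,3)[OF this]
    have fm: "?f' \<in> borel_measurable borel" "?g' \<in> borel_measurable borel"
      using borel_measurable_integrable[OF f'i] borel_measurable_integrable[OF g'i] by simp_all
    have "dist_nl_hessian r u i j \<phi> = (LINT x|lborel. ?f' x)"
      unfolding dist_nl_hessian_def by (rule f(2)[OF fm(1)])
    also have "\<dots> = (LINT x|lborel. ?g' x)"
      unfolding integral_matrix_component[OF p(1)] integral_matrix_component[OF p(2)] p(3) ..
    also have "\<dots> = (LINT x|lebesgue. nl_hessian r u x $ i $ j * \<phi> x)"
      by (rule g(2)[OF fm(2), symmetric])
    finally show ?thesis
      using ex\<phi> f(1)[OF fm(1)] f'i g(1)[OF fm(2)] g'i by blast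
  qed

  have rep: "represents_dist_nl_hessian r u (nl_hessian r u)"
    unfolding represents_dist_nl_hessian_def
    using Hui test[OF C_c_infty_imp_C_c_k] by (intro conjI allI impI) blast+
  have unique: "AE x in lebesgue. nl_hessian r u x = V x" if V: "represents_dist_nl_hessian r u V" for V
  proof -
    have "AE x in lebesgue. nl_hessian r u x $ i $ j = V x $ i $ j" for i j
    proof (rule AE_eq_if_same_pairing_with_C_c_infty)
      show "integrable lebesgue (\<lambda>x. nl_hessian r u x $ i $ j)"
        by (rule integrable_matrix_component[OF Hui])
      show "integrable lebesgue (\<lambda>x. V x $ i $ j)"
        using V by (intro integrable_matrix_component) (simp add: represents_dist_nl_hessian_def)
      show "(LINT x|lebesgue. nl_hessian r u x $ i $ j * \<phi> x) = (LINT x|lebesgue. V x $ i $ j * \<phi> x)"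
        if \<phi>: "C_c_infty \<phi>" for \<phi>
        using rep[unfolded represents_dist_nl_hessian_def, THEN conjunct2, rule_format, OF \<phi>, of i j]
          V[unfolded represents_dist_nl_hessian_def, THEN conjunct2, rule_format, OF \<phi>, of i j] by simp
    qed
    then have "AE x in lebesgue. \<forall>i\<in>UNIV. \<forall>j\<in>UNIV. nl_hessian r u x $ i $ j = V x $ i $ j"
      by (intro AE_finite_allI) auto
    then show ?thesis by eventually_elim (simp add: vec_eq_iff)
  qed
  show ?thesis
    unfolding r_def[symmetric] using rep test ex unique by (intro conjI exI allI impI) auto
qed

end
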